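(* Let $f=(f_1,\dots,f_n):\{0,1\}^n\to\{0,1\}^n$ be a $k$-independent Boolean network whose interaction graph $G(f)$ has no loops. Then $IC(f_i)\geq k$ for every $i\in[n]$.
   Context: The interaction graph $G(f)$ is the digraph on $[n]$ with an arc $(i,j)$ iff there is $x\in\{0,1\}^n$ such that changing $x_i$ from $0$ to $1$ changes the value of $f_j(x)$; a loop is an arc $(i,i)$. $\mathrm{FP}(f)=\{x:f(x)=x\}$. For $I=\{i_1,\dots,i_k\}\subseteq[n]$, $x_I=(x_{i_1},\dots,x_{i_k})$. $f$ is $k$-independent if for every $k$-subset $I\subseteq[n]$ and every $a\in\{0,1\}^k$ there is $x\in\mathrm{FP}(f)$ with $x_I=a$. A function $h:\{0,1\}^n\to\{0,1\}$ is $k$-set canalizing if there exist $I\subseteq[n]$ with $|I|=k$ and values $a\in\{0,1\}^k$, $b\in\{0,1\}$ such that for all $x\in\{0,1\}^n$, $x_I=a$ implies $h(x)=b$. $IC(h)$ denotes the minimum $k$ such that $h$ is $k$-set canalizing.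
   Formalization: The assumption k ≤ n is made explicit: for k > n there are no k-subsets of [n], so every network is vacuously k-independent while IC(f_i) ≤ n < k, and the claim would fail. *)

theory Defs
  imports "HOL-Library.FuncSet" "HOL-Library.Cardinality"
begin

text \<open>The index set \<open>[n]\<close> is a finite type \<open>'n\<close>, so \<open>n = CARD('n)\<close>, and
  \<open>{0,1}\<^sup>n\<close> is \<open>'n \<Rightarrow> bool\<close>.  The subtuple \<open>x\<^sub>I\<close> is \<open>restrict x I\<close>, and a value tuple
  \<open>a \<in> {0,1}\<^sup>k\<close> for the coordinates in \<open>I\<close> is an element of \<open>I \<rightarrow>\<^sub>E UNIV\<close>.\<close>

type_synonym 'n config = "'n \<Rightarrow> bool"

definition interaction_graph :: "('n::finite config \<Rightarrow> 'n config) \<Rightarrow> ('n \<times> 'n) set" where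
  "interaction_graph f = {(i, j). \<exists>x. \<not> x i \<and> f (x(i := True)) j \<noteq> f x j}"

definition FP :: "('n::finite config \<Rightarrow> 'n config) \<Rightarrow> 'n config set" where
  "FP f = {x. f x = x}"

definition k_independent :: "nat \<Rightarrow> ('n::finite config \<Rightarrow> 'n config) \<Rightarrow> bool" where
  "k_independent k f \<longleftrightarrow>
     (\<forall>I. card I = k \<longrightarrow> (\<forall>a \<in> I \<rightarrow>\<^sub>E UNIV. \<exists>x \<in> FP f. restrict x I = a))"

definition set_canalizing :: "nat \<Rightarrow> ('n::finite config \<Rightarrow> bool) \<Rightarrow> bool" where
  "set_canalizing k h \<longleftrightarrow>
     (\<exists>I. card I = k \<and> (\<exists>a \<in> I \<rightarrow>\<^sub>E UNIV. \<exists>b. \<forall>x. restrict x I = a \<longrightarrow> h x = b))"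

definition IC :: "('n::finite config \<Rightarrow> bool) \<Rightarrow> nat" where
  "IC h = (LEAST k. set_canalizing k h)"

text \<open>The minimum defining \<open>IC\<close> is taken over a nonempty set.\<close>

lemma set_canalizing_card: "set_canalizing CARD('n) (h :: 'n::finite config \<Rightarrow> bool)"
  unfolding set_canalizing_def
  by (rule exI[of _ UNIV]) (auto simp: restrict_UNIV)

lemma set_canalizing_IC: "set_canalizing (IC h) h"
  unfolding IC_def by (rule LeastI) (rule set_canalizing_card)

end

theory Submission imports Defs begin

text \<open>Without a loop at \<open>i\<close>, the function \<open>f\<^sub>i\<close> ignores \<open>x\<^sub>i\<close>. So if fixing \<open>x\<^sub>I = a\<close> with
  \<open>|I| < k\<close> forces \<open>f\<^sub>i = b\<close>, then fixing only the coordinates in \<open>I - {i}\<close> already does.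
  Since \<open>|I \<union> {i}| \<le> k\<close>, some fixed point has these coordinates and \<open>x\<^sub>i \<noteq> b\<close>: a contradiction.\<close>

lemma no_loop_fun_upd:
  assumes "(i, i) \<notin> interaction_graph f"
  shows "f (x(i := v)) i = f x i"
proof -
  have *: "f (y(i := True)) i = f y i" if "\<not> y i" for y
    using assms that by (auto simp: interaction_graph_def)
  \<comment> \<open>Arcs are defined by raising a coordinate from \<open>False\<close>, so the
    comparison starts at \<open>x(i := False)\<close>.\<close>
  have "f (x(i := True)) i = f (x(i := False)) i"
    using *[of "x(i := False)"] by simp
  moreover have "x = x(i := True) \<or> x = x(i := False)"
    by (cases "x i") (auto simp: fun_eq_iff)
  ultimately show ?thesis
    by metis
qed

text \<open>Independence prescribes exactly \<open>k\<close> coordinates, so \<open>J\<close> is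
  enlarged to a set \<open>K\<close> of size \<open>k\<close>. This needs
  \<open>k \<le> CARD('n)\<close>; for larger \<open>k\<close> independence holds vacuously.\<close>

lemma k_independent_agree:
  fixes f :: "'n::finite config \<Rightarrow> 'n config"
  assumes "k_independent k f" "k \<le> CARD('n)" "card J \<le> k"
  obtains x where "f x = x" "\<And>j. j \<in> J \<Longrightarrow> x j = c j"
proof -
  obtain K where K: "J \<subseteq> K" "card K = k"
    using exists_subset_between[of J k UNIV] assms(2,3) by auto
  have "restrict c K \<in> K \<rightarrow>\<^sub>E UNIV"
    by auto
  then obtain x where x: "x \<in> FP f" "restrict x K = restrict c K"
    using assms(1) K(2) unfolding k_independent_def by blast
  have "x j = c j" if "j \<in> J" for j
    using fun_cong[OF x(2), of j] K(1) that by (auto simp: restrict_def)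
  with x(1) that show thesis
    by (auto simp: FP_def)
qed

lemma k_independent_set_canalizing_ge:
  fixes f :: "'n::finite config \<Rightarrow> 'n config"
  assumes "k_independent k f" "k \<le> CARD('n)" "(i, i) \<notin> interaction_graph f"
    and "set_canalizing m (\<lambda>x. f x i)"
  shows "k \<le> m"
proof (rule ccontr)
  assume "\<not> k \<le> m"
  obtain I a b where I: "card I = m" "a \<in> I \<rightarrow>\<^sub>E UNIV"
    and canal: "\<And>x. restrict x I = a \<Longrightarrow> f x i = b"
    using assms(4) unfolding set_canalizing_def by blast
  have "card (insert i I) \<le> k"
    using \<open>\<not> k \<le> m\<close> I(1) by (simp add: card_insert_if)
  then obtain x where x: "f x = x" "\<And>j. j \<in> insert i I \<Longrightarrow> x j = (a(i := \<not> b)) j"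
    using k_independent_agree[OF assms(1,2)] by blast
  \<comment> \<open>If \<open>i\<close> is in \<open>I\<close>, \<open>x i\<close> may differ from
    \<open>a i\<close>; the reset repairs this and, without a loop, preserves \<open>f x i\<close>.
    Otherwise it leaves the restriction to \<open>I\<close> unchanged.\<close>
  have "restrict (x(i := a i)) I = a"
    using x(2) I(2) by (auto simp: fun_eq_iff restrict_def PiE_def extensional_def)
  then have "f x i = b"
    using canal no_loop_fun_upd[where v = "a i", OF assms(3)] by metis
  moreover have "f x i = (\<not> b)"
    using x by simp
  ultimately show False
    by simp
qed

theorem theorem2p5:
  fixes f :: "'n::finite config \<Rightarrow> 'n config" and k :: nat
  assumes "k \<le> CARD('n)"
    and "k_independent k f"
    and "\<forall>i. (i, i) \<notin> interaction_graph f"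
  shows "\<forall>i. IC (\<lambda>x. f x i) \<ge> k"
  using assms k_independent_set_canalizing_ge set_canalizing_IC by blast

end
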